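(* Let $0\le d\le \tfrac12$ and $z\in\mathbb{R}$. Then \[ \frac{8z}{\pi^2}\sum_{n=1,3,5,\ldots}\frac{\cos(2\pi n d)}{n^2+\dfrac{4z^2}{\pi^2}}=\frac{\sinh\bigl(z(1-4d)\bigr)}{\cosh z}, \] where the sum is over all positive odd integers $n$. *)

theory Defs
  imports "HOL-Analysis.Analysis"
begin

end

theory Submission
  imports Defs
begin

text \<open>
  Put \<open>\<theta> = 2 \<pi> d \<in> [0, \<pi>]\<close> and \<open>a = 2 z / \<pi>\<close>. The identity says that
  \<open>sinh (a (\<pi>/2 - \<theta>))\<close> is the sum of its cosine series on \<open>[0, \<pi>]\<close>. Its cosine coefficients
  are elementary, because the function is an eigenfunction of the second derivative
  (\<open>sinh_cos_has_integral\<close>); antisymmetry about \<open>\<pi>/2\<close> removes those of even index.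

  The coefficients decay like \<open>1/n\<^sup>2\<close>, so no kernel estimate is needed for convergence: the series
  converges uniformly to some continuous function, which may be integrated term by term and
  therefore has the same cosine coefficients as the given one. It remains to see that a continuous
  function on \<open>[0, \<pi>]\<close> is determined by its cosine coefficients
  (\<open>cosine_moments_zero_imp_zero\<close>). This follows from the Weierstrass approximation theorem after the
  substitution \<open>x = cos \<theta>\<close>, which turns \<open>[0, \<pi>]\<close> into \<open>[-1, 1]\<close> and polynomials in \<open>x\<close> into
  cosine polynomials.
\<close>

section \<open>Cosine series on the interval from 0 to pi\<close>

text \<open>
  The product formula for cosines lowers the power of \<open>cos x\<close> at the price of shifting \<open>m\<close>,
  whence the quantification over all \<open>m\<close>.
\<close>

lemma cosine_moments_zero_imp_power_moments_zero:
  fixes g :: "real \<Rightarrow> real"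
  assumes "\<And>m::nat. ((\<lambda>x. g x * cos (real m * x)) has_integral 0) S"
  shows "((\<lambda>x. g x * cos (real m * x) * cos x ^ k) has_integral 0) S"
proof (induction k arbitrary: m)
  case 0
  then show ?case using assms by simp
next
  case (Suc k)
  show ?case
  proof (cases m)
    case 0
    then show ?thesis using Suc[of 1] by (simp add: mult_ac)
  next
    case (Suc l)
    have eq: "g x * cos (real m * x) * cos x ^ Suc k =
        (g x * cos (real (Suc m) * x) * cos x ^ k + g x * cos (real l * x) * cos x ^ k) * (1/2)" for x
    proof -
      have "cos (real (Suc m) * x) + cos (real l * x) = 2 * (cos (real m * x) * cos x)"
        using cos_add[of "real m * x" x] cos_diff[of "real m * x" x] Suc
        by (simp add: algebra_simps)
      then have "(g x * cos x ^ k) * (cos (real (Suc m) * x) + cos (real l * x)) =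
          (g x * cos x ^ k) * (2 * (cos (real m * x) * cos x))"
        by simp
      then show ?thesis by (simp add: algebra_simps)
    qed
    show ?thesis
      unfolding eq
      using has_integral_mult_left[OF has_integral_add[OF Suc.IH[of "Suc m"] Suc.IH[of l]], of "1/2"]
      by simp
  qed
qed

text \<open>
  A function orthogonal to all powers of \<open>cos x\<close> is orthogonal to the uniform closure of their
  span. By the Weierstrass theorem this closure contains the function itself, whose square
  then has integral zero.
\<close>

lemma cosine_moments_zero_imp_zero:
  fixes g :: "real \<Rightarrow> real"
  assumes cont: "continuous_on {0..pi} g"
    and moments: "\<And>m::nat. ((\<lambda>x. g x * cos (real m * x)) has_integral 0) {0..pi}"
    and x: "x \<in> {0..pi}"
  shows "g x = 0"
proof -
  define C where "C = integral {0..pi} (\<lambda>x. \<bar>g x\<bar>)"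
  define J where "J = integral {0..pi} (\<lambda>x. g x * g x)"
  have int_abs: "(\<lambda>x. \<bar>g x\<bar>) integrable_on {0..pi}"
    by (intro integrable_continuous_real continuous_intros cont)
  have contsq: "continuous_on {0..pi} (\<lambda>x. g x * g x)"
    by (intro continuous_intros cont)
  have sq: "((\<lambda>x. g x * g x) has_integral J) {0..pi}"
    unfolding J_def by (intro integrable_integral integrable_continuous_real contsq)
  have C: "0 \<le> C" unfolding C_def by (intro integral_nonneg int_abs) auto
  \<comment> \<open>\<open>J\<close> is also the integral of \<open>g x * (g x - p (cos x))\<close>, with \<open>p (cos x)\<close> within \<open>e\<close> of \<open>g x\<close>\<close>
  have bound: "J \<le> e * C" if e: "0 < e" for e
  proof -
    have "continuous_on {-1..1} (\<lambda>t. g (arccos t))"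
      by (rule continuous_on_compose2[OF cont continuous_on_arccos'])
        (auto simp: arccos_lbound arccos_ubound)
    then obtain p where p: "real_polynomial_function p"
        and approx: "\<And>t. t \<in> {-1..1} \<Longrightarrow> \<bar>g (arccos t) - p t\<bar> < e"
      using Stone_Weierstrass_real_polynomial_function[OF compact_Icc _ e] by blast
    obtain c n where c: "p = (\<lambda>t. \<Sum>i\<le>n. c i * t ^ i)"
      using real_polynomial_function_imp_sum[OF p] by (auto simp: fun_eq_iff)
    have "((\<lambda>x. \<Sum>i\<le>n. c i * (g x * cos (real 0 * x) * cos x ^ i)) has_integral
        (\<Sum>i\<le>n. c i * 0)) {0..pi}"
      by (intro has_integral_sum has_integral_mult_right
            cosine_moments_zero_imp_power_moments_zero moments) auto
    then have "((\<lambda>x. g x * p (cos x)) has_integral 0) {0..pi}"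
      by (simp add: c sum_distrib_left mult_ac)
    from has_integral_diff[OF sq this]
    have diff: "((\<lambda>x. g x * g x - g x * p (cos x)) has_integral J) {0..pi}" by simp
    have le: "g x * g x - g x * p (cos x) \<le> e * \<bar>g x\<bar>" if "x \<in> {0..pi}" for x
    proof -
      have "\<bar>g x - p (cos x)\<bar> \<le> e"
        using approx[of "cos x"] that by (auto simp: arccos_cos less_imp_le)
      then have "\<bar>g x\<bar> * \<bar>g x - p (cos x)\<bar> \<le> \<bar>g x\<bar> * e" by (intro mult_left_mono) auto
      moreover have "g x * g x - g x * p (cos x) \<le> \<bar>g x\<bar> * \<bar>g x - p (cos x)\<bar>"
        by (metis abs_ge_self abs_mult right_diff_distrib)
      ultimately show ?thesis by (simp add: mult.commute)
    qed
    have "((\<lambda>x. e * \<bar>g x\<bar>) has_integral e * C) {0..pi}"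
      unfolding C_def by (intro has_integral_mult_right integrable_integral int_abs)
    from has_integral_le[OF diff this le] show ?thesis .
  qed
  have "J \<le> 0"
  proof (rule field_le_epsilon)
    fix e :: real assume e: "0 < e"
    have "J \<le> e / (C + 1) * C" using e C by (intro bound) simp
    also have "\<dots> \<le> e" using e C by (simp add: field_simps)
    finally show "J \<le> 0 + e" by simp
  qed
  moreover have "0 \<le> J" unfolding J_def
    by (intro integral_nonneg integrable_continuous_real contsq) auto
  ultimately have "integral {0..pi} (\<lambda>x. g x * g x) = 0" unfolding J_def by simp
  then have "\<forall>x\<in>{0..pi}. g x * g x = 0"
    by (subst (asm) integral_eq_0_iff[OF contsq]) auto
  then show ?thesis using x by auto
qed

lemma cos_mult_nat_has_integral:
  "((\<lambda>x. cos (real n * x)) has_integral (if n = 0 then pi else 0)) {0..pi}"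
proof (cases "n = 0")
  case True
  then show ?thesis using has_integral_const_real[of "1::real" 0 pi] by simp
next
  case False
  have "((\<lambda>x. cos (real n * x)) has_integral
      (sin (real n * pi) / real n - sin (real n * 0) / real n)) {0..pi}"
    using False
    by (intro fundamental_theorem_of_calculus)
      (auto intro!: derivative_eq_intros simp flip: has_real_derivative_iff_has_vector_derivative)
  then show ?thesis using False by simp
qed

lemma cos_mult_cos_has_integral:
  "((\<lambda>x. cos (real n * x) * cos (real m * x)) has_integral
      (if n = m then if m = 0 then pi else pi / 2 else 0)) {0..pi}"
proof (induction n m rule: linorder_wlog)
  case (sym n m)
  then show ?case by (cases "n = m") (simp_all add: mult.commute)
next
  case (le n m)
  have eq: "cos (real n * x) * cos (real m * x) =
      (cos (real (m - n) * x) + cos (real (m + n) * x)) * (1/2)" for x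
    using cos_add[of "real m * x" "real n * x"] cos_diff[of "real m * x" "real n * x"] le
    by (simp add: of_nat_diff algebra_simps)
  have "((if m - n = 0 then pi else 0) + (if m + n = 0 then pi else 0)) * (1/2) =
      (if n = m then if m = 0 then pi else pi / 2 else 0)"
    using le by auto
  with has_integral_mult_left[OF has_integral_add[OF
      cos_mult_nat_has_integral[of "m - n"] cos_mult_nat_has_integral[of "m + n"]], of "1/2"]
  show ?case by (simp only: eq)
qed

text \<open>
  The partial sums over finite index sets converge uniformly, so both continuity and integrals pass
  to the limit.
\<close>

lemma dominated_infsum_continuous_and_integral:
  fixes f :: "'i \<Rightarrow> real \<Rightarrow> real"
  assumes cont: "\<And>n. continuous_on {a..b} (f n)"
    and bound: "\<And>n x. x \<in> {a..b} \<Longrightarrow> \<bar>f n x\<bar> \<le> M n"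
    and M: "M summable_on A"
    and I: "\<And>n. (f n has_integral I n) {a..b}"
  shows "continuous_on {a..b} (\<lambda>x. \<Sum>\<^sub>\<infinity>n\<in>A. f n x)"
    and "(I has_sum integral {a..b} (\<lambda>x. \<Sum>\<^sub>\<infinity>n\<in>A. f n x)) A"
proof -
  let ?S = "\<lambda>X x. \<Sum>n\<in>X. f n x" and ?s = "\<lambda>x. \<Sum>\<^sub>\<infinity>n\<in>A. f n x"
  have lim: "uniform_limit {a..b} ?S ?s (finite_subsets_at_top A)"
    by (rule Weierstrass_m_test_general[OF _ M]) (use bound in auto)
  have cont_S: "continuous_on {a..b} (?S X)" for X
    by (intro continuous_on_sum cont)
  show "continuous_on {a..b} ?s"
    by (rule uniform_limit_theorem[OF _ lim]) (auto intro: cont_S)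
  obtain K J where K: "\<And>X. (?S X has_integral K X) {a..b}" and J: "(?s has_integral J) {a..b}"
      and KJ: "(K \<longlongrightarrow> J) (finite_subsets_at_top A)"
    using uniform_limit_integral[OF lim cont_S finite_subsets_at_top_neq_bot] by blast
  have "\<forall>\<^sub>F X in finite_subsets_at_top A. K X = sum I X"
  proof (rule eventually_finite_subsets_at_top_weakI)
    fix X :: "'i set" assume "finite X"
    then show "K X = sum I X"
      using has_integral_unique[OF K has_integral_sum[of X f I]] I by blast
  qed
  with KJ have "(sum I \<longlongrightarrow> J) (finite_subsets_at_top A)"
    by (rule Lim_transform_eventually)
  then show "(I has_sum integral {a..b} ?s) A"
    using integral_unique[OF J] by (simp add: has_sum_def)
qed

text \<open>
  The hypothesis on \<open>f\<close> says that \<open>b\<close> is its sequence of cosine coefficients; by orthogonality the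
  sum of the series has the same ones.
\<close>

theorem absolutely_convergent_cosine_series_has_sum:
  fixes f :: "real \<Rightarrow> real" and b :: "nat \<Rightarrow> real"
  assumes cont: "continuous_on {0..pi} f"
    and b: "(\<lambda>n. \<bar>b n\<bar>) summable_on UNIV"
    and coeff: "\<And>m. ((\<lambda>x. f x * cos (real m * x)) has_integral
                  b m * (if m = 0 then pi else pi / 2)) {0..pi}"
    and x: "x \<in> {0..pi}"
  shows "((\<lambda>n. b n * cos (real n * x)) has_sum f x) UNIV"
proof -
  define s where "s = (\<lambda>x. \<Sum>\<^sub>\<infinity>n. b n * cos (real n * x))"
  have dom: "\<bar>b n * cos (real n * x)\<bar> \<le> \<bar>b n\<bar>" for n x
    by (simp add: abs_mult mult_left_le)
  have cont_s: "continuous_on {0..pi} s"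
    unfolding s_def
  proof (rule dominated_infsum_continuous_and_integral(1)[OF _ dom b])
    show "continuous_on {0..pi} (\<lambda>x. b n * cos (real n * x))" for n
      by (intro continuous_intros)
    show "((\<lambda>x. b n * cos (real n * x)) has_integral b n * (if n = 0 then pi else 0)) {0..pi}" for n
      by (rule has_integral_mult_right[OF cos_mult_nat_has_integral])
  qed
  have s_coeff: "((\<lambda>x. s x * cos (real m * x)) has_integral
      b m * (if m = 0 then pi else pi / 2)) {0..pi}" for m
  proof -
    let ?w = "if m = 0 then pi else pi / 2"
    let ?I = "\<lambda>n. b n * (if n = m then ?w else 0)"
    have cont_product: "continuous_on {0..pi} (\<lambda>x. b n * (cos (real n * x) * cos (real m * x)))" for n
      by (intro continuous_intros)
    have "\<bar>b n * (cos (real n * x) * cos (real m * x))\<bar> \<le> \<bar>b n\<bar>" for n x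
      by (simp add: abs_mult mult_left_le mult_le_one)
    then have "(?I has_sum integral {0..pi}
        (\<lambda>x. \<Sum>\<^sub>\<infinity>n. b n * (cos (real n * x) * cos (real m * x)))) UNIV"
      by (rule dominated_infsum_continuous_and_integral(2)[OF cont_product _ b
            has_integral_mult_right[OF cos_mult_cos_has_integral]])
    moreover have "(\<Sum>\<^sub>\<infinity>n. b n * (cos (real n * x) * cos (real m * x))) = s x * cos (real m * x)" for x
      unfolding s_def
      by (subst infsum_cmult_left'[symmetric]) (simp add: mult_ac)
    ultimately have "(?I has_sum integral {0..pi} (\<lambda>x. s x * cos (real m * x))) UNIV"
      by simp
    moreover have "(?I has_sum ?I m) UNIV"
      by (rule has_sum_finite_neutralI[of "{m}"]) auto
    ultimately have "integral {0..pi} (\<lambda>x. s x * cos (real m * x)) = ?I m"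
      by (rule has_sum_unique)
    moreover have "(\<lambda>x. s x * cos (real m * x)) integrable_on {0..pi}"
      by (intro integrable_continuous_real continuous_intros cont_s)
    ultimately show ?thesis by (simp add: has_integral_integrable_integral)
  qed
  have "f x - s x = 0"
  proof (rule cosine_moments_zero_imp_zero[OF _ _ x])
    show "continuous_on {0..pi} (\<lambda>x. f x - s x)" by (intro continuous_intros cont cont_s)
    show "((\<lambda>x. (f x - s x) * cos (real m * x)) has_integral 0) {0..pi}" for m
      using has_integral_diff[OF coeff[of m] s_coeff[of m]] by (simp add: left_diff_distrib)
  qed
  moreover have "(\<lambda>n. b n * cos (real n * x)) summable_on UNIV"
    by (rule abs_summable_summable[OF Infinite_Sum.abs_summable_on_comparison_test'[OF b]]) (use dom in auto)
  then have "((\<lambda>n. b n * cos (real n * x)) has_sum s x) UNIV"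
    unfolding s_def by (rule has_sum_infsum)
  ultimately show ?thesis by simp
qed

section \<open>The hyperbolic sine\<close>

text \<open>
  With \<open>h x = sinh (a (\<pi>/2 - x))\<close> we have \<open>h'' = a\<^sup>2 h\<close>, so that
  \<open>h' cos (m x) + m h sin (m x)\<close> has derivative \<open>(a\<^sup>2 + m\<^sup>2) h cos (m x)\<close>.
\<close>

lemma sinh_cos_has_integral:
  fixes a :: real
  assumes a: "a \<noteq> 0"
  shows "((\<lambda>x. sinh (a * (pi / 2 - x)) * cos (real m * x)) has_integral
      (if odd m then 2 * a * cosh (a * pi / 2) / ((real m)\<^sup>2 + a\<^sup>2) else 0)) {0..pi}"
proof -
  define D where "D = (real m)\<^sup>2 + a\<^sup>2"
  have D: "D > 0" using a unfolding D_def by (simp add: add_nonneg_pos)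
  define P where "P = (\<lambda>x. (real m * sinh (a * (pi / 2 - x)) * sin (real m * x)
      - a * cosh (a * (pi / 2 - x)) * cos (real m * x)) / D)"
  have "((\<lambda>x. sinh (a * (pi / 2 - x)) * cos (real m * x)) has_integral (P pi - P 0)) {0..pi}"
  proof (rule fundamental_theorem_of_calculus)
    fix x :: real
    define s c where "s = sinh (a * (pi / 2 - x))" and "c = cosh (a * (pi / 2 - x))"
    have "((\<lambda>x. real m * sinh (a * (pi / 2 - x)) * sin (real m * x)
          - a * cosh (a * (pi / 2 - x)) * cos (real m * x)) has_real_derivative
        (real m * (c * (- a)) * sin (real m * x) + real m * s * (cos (real m * x) * real m))
          - (a * (s * (- a)) * cos (real m * x) + a * c * (- sin (real m * x) * real m)))
        (at x within {0..pi})"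
      unfolding s_def c_def by (rule derivative_eq_intros refl | simp)+
    also have "(real m * (c * (- a)) * sin (real m * x) + real m * s * (cos (real m * x) * real m))
          - (a * (s * (- a)) * cos (real m * x) + a * c * (- sin (real m * x) * real m))
        = s * cos (real m * x) * D"
      unfolding D_def by algebra
    finally have "(P has_real_derivative (sinh (a * (pi / 2 - x)) * cos (real m * x) * D / D))
        (at x within {0..pi})"
      unfolding P_def s_def by (rule DERIV_cdivide)
    then show "(P has_vector_derivative sinh (a * (pi / 2 - x)) * cos (real m * x)) (at x within {0..pi})"
      using D by (simp add: has_real_derivative_iff_has_vector_derivative)
  qed simp
  moreover have "P pi - P 0 = (if odd m then 2 * a * cosh (a * pi / 2) / D else 0)"
  proof -
    have "cosh (a * (pi / 2 - pi)) = cosh (a * pi / 2)"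
      by (subst cosh_minus[symmetric]) (simp add: field_simps)
    then show ?thesis
      by (auto simp: P_def cos_npi power_minus_odd simp flip: add_divide_distrib diff_divide_distrib)
  qed
  ultimately show ?thesis by (simp only: D_def)
qed

lemma inverse_square_plus_const_summable_on:
  fixes c :: real
  assumes "0 \<le> c"
  shows "(\<lambda>n::nat. 1 / ((real n)\<^sup>2 + c)) summable_on {n. odd n}"
proof -
  have "(\<lambda>n::nat. inverse (real n ^ 2)) summable_on UNIV"
    using inverse_power_summable[of 2, where 'a = real]
    by (subst summable_on_UNIV_nonneg_real_iff) auto
  then have "(\<lambda>n::nat. inverse (real n ^ 2)) summable_on {n. odd n}"
    by (rule summable_on_subset_banach) simp
  then show ?thesis
  proof (rule abs_summable_summable[OF Infinite_Sum.abs_summable_on_comparison_test'])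
    fix n :: nat assume "n \<in> {n. odd n}"
    then have "n > 0" by (auto elim: oddE)
    then have "1 / ((real n)\<^sup>2 + c) \<le> 1 / (real n)\<^sup>2" using assms by (intro frac_le) auto
    then show "norm (1 / ((real n)\<^sup>2 + c)) \<le> inverse (real n ^ 2)"
      using assms by (simp add: inverse_eq_divide)
  qed
qed

theorem theorem1:
  fixes d z :: real
  assumes "0 \<le> d" and "d \<le> 1 / 2"
  shows "(\<lambda>n::nat. cos (2 * pi * real n * d) / ((real n)\<^sup>2 + 4 * z\<^sup>2 / pi\<^sup>2))
           summable_on {n. odd n} \<and>
         8 * z / pi\<^sup>2 *
           (\<Sum>\<^sub>\<infinity>n\<in>{n::nat. odd n}. cos (2 * pi * real n * d) / ((real n)\<^sup>2 + 4 * z\<^sup>2 / pi\<^sup>2))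
         = sinh (z * (1 - 4 * d)) / cosh z"
proof -
  let ?O = "{n::nat. odd n}"
  define t where "t = (\<lambda>n::nat. cos (2 * pi * real n * d) / ((real n)\<^sup>2 + 4 * z\<^sup>2 / pi\<^sup>2))"
  note summable = inverse_square_plus_const_summable_on[of "4 * z\<^sup>2 / pi\<^sup>2", simplified]
  have "t summable_on ?O"
    by (rule abs_summable_summable[OF Infinite_Sum.abs_summable_on_comparison_test'[OF summable]])
      (auto simp: t_def abs_mult divide_right_mono)
  moreover have "8 * z / pi\<^sup>2 * infsum t ?O = sinh (z * (1 - 4 * d)) / cosh z"
  proof (cases "z = 0")
    case False
    define a where "a = 2 * z / pi"
    have a: "a \<noteq> 0" "a * pi / 2 = z" "a\<^sup>2 = 4 * z\<^sup>2 / pi\<^sup>2"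
      using False by (auto simp: a_def power_divide power_mult_distrib)
    \<comment> \<open>\<open>k = 4 a cosh z / \<pi>\<close>, the integral for odd index divided by \<open>\<pi>/2\<close>\<close>
    define k where "k = 8 * z / pi\<^sup>2 * cosh z"
    define b where "b = (\<lambda>n::nat. if odd n then k / ((real n)\<^sup>2 + 4 * z\<^sup>2 / pi\<^sup>2) else 0)"
    have b: "(\<lambda>n. \<bar>b n\<bar>) summable_on UNIV"
      by (rule iffD1[OF summable_on_cong_neutral summable_on_cmult_right[OF summable, of "\<bar>k\<bar>"]])
        (auto simp: b_def)
    have coeff: "((\<lambda>x. sinh (a * (pi / 2 - x)) * cos (real m * x)) has_integral
        b m * (if m = 0 then pi else pi / 2)) {0..pi}" for m
    proof -
      have "(if odd m then 2 * a * cosh (a * pi / 2) / ((real m)\<^sup>2 + a\<^sup>2) else 0)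
          = b m * (if m = 0 then pi else pi / 2)"
        unfolding a(2,3) by (auto simp: b_def k_def a_def power2_eq_square)
      with sinh_cos_has_integral[OF a(1), of m] show ?thesis by (simp only:)
    qed
    have "((\<lambda>n. b n * cos (real n * (2 * pi * d))) has_sum sinh (a * (pi / 2 - 2 * pi * d))) UNIV"
    proof (rule absolutely_convergent_cosine_series_has_sum[OF _ b coeff])
      show "continuous_on {0..pi} (\<lambda>x. sinh (a * (pi / 2 - x)))" by (intro continuous_intros)
      show "2 * pi * d \<in> {0..pi}" using assms by simp
    qed
    then have "((\<lambda>n. k * t n) has_sum sinh (a * (pi / 2 - 2 * pi * d))) ?O"
      by (rule iffD1[OF has_sum_cong_neutral, rotated -1]) (auto simp: b_def t_def mult_ac)
    then have "k * infsum t ?O = sinh (a * (pi / 2 - 2 * pi * d))"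
      by (metis infsumI infsum_cmult_right')
    also have "a * (pi / 2 - 2 * pi * d) = z * (1 - 4 * d)"
      by (simp add: a_def field_simps)
    finally have "k * infsum t ?O / cosh z = sinh (z * (1 - 4 * d)) / cosh z" by simp
    moreover have "k * infsum t ?O / cosh z = 8 * z / pi\<^sup>2 * infsum t ?O"
      unfolding k_def by simp
    ultimately show ?thesis by simp
  qed simp
  ultimately show ?thesis unfolding t_def by blast
qed

end
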